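(* For $P \subseteq \mathbb{R}^2$, the function $\operatorname{opx}(n, P)$ is continuous in $n$ for $n > 0$.
   Context: Containment for subsets of the plane: for $P, S \subseteq \mathbb{R}^2$, let $X_P, Y_P$ be the sets of $x$-coordinates and $y$-coordinates of points of $P$, and $X_S, Y_S$ likewise for $S$. $S$ contains $P$ if there exist functions $f_X: X_P \to X_S$ and $f_Y: Y_P \to Y_S$ such that (1) $\frac{f_X(x_0)-f_X(x_1)}{x_0-x_1} \ge 1$ for all $x_0 > x_1$ in $X_P$; (2) $\frac{f_Y(y_0)-f_Y(y_1)}{y_0-y_1} \ge 1$ for all $y_0 > y_1$ in $Y_P$; (3) $(f_X(x), f_Y(y)) \in S$ for all $(x,y) \in P$. Otherwise $S$ is $P$-free. For real $n > 0$, $\operatorname{opx}(n,P)$ is the supremum of the Lebesgue measure $\mu_2(S)$ over all open $P$-free subsets $S \subseteq [0,n]^2$. *)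

theory Defs
  imports "HOL-Analysis.Analysis"
begin

definition contains_config :: "(real \<times> real) set \<Rightarrow> (real \<times> real) set \<Rightarrow> bool" where
  "contains_config S P \<longleftrightarrow>
    (\<exists>fX fY. fX \<in> fst ` P \<rightarrow> fst ` S \<and> fY \<in> snd ` P \<rightarrow> snd ` S \<and>
      (\<forall>x0\<in>fst ` P. \<forall>x1\<in>fst ` P. x0 > x1 \<longrightarrow> (fX x0 - fX x1) / (x0 - x1) \<ge> 1) \<and>
      (\<forall>y0\<in>snd ` P. \<forall>y1\<in>snd ` P. y0 > y1 \<longrightarrow> (fY y0 - fY y1) / (y0 - y1) \<ge> 1) \<and>
      (\<forall>(x, y)\<in>P. (fX x, fY y) \<in> S))"

definition config_free :: "(real \<times> real) set \<Rightarrow> (real \<times> real) set \<Rightarrow> bool" where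
  "config_free P S \<longleftrightarrow> \<not> contains_config S P"

text \<open>
  The measures below are bounded above by the area of the square, so for nonempty P (where the
  empty set is P-free) this is the genuine supremum in the reals. If P is empty, every set
  contains P, so the supremum is over the empty set: an unspecified constant that does not
  depend on n.
\<close>

definition opx :: "real \<Rightarrow> (real \<times> real) set \<Rightarrow> real" where
  "opx n P = Sup {measure lebesgue S | S. open S \<and> config_free P S \<and> S \<subseteq> {0..n} \<times> {0..n}}"

end

theory Submission
  imports Defs
begin

text \<open>
  Shrinking a set keeps it \<open>P\<close>-free, because magnifying the set magnifies the two maps of a
  containment and so keeps their difference quotients at least 1. Hence, for nonempty \<open>P\<close>, \<open>opx n P\<close> is
  nondecreasing in \<open>n\<close> while \<open>opx n P / n\<^sup>2\<close> is nonincreasing, and continuity follows by squeezing.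
\<close>

lemma contains_config_empty: "contains_config S {}"
  by (simp add: contains_config_def)

text \<open>A point of \<open>P\<close> would need an image in the empty set. This supplies a member
  of the family whose supremum defines \<open>opx\<close>.\<close>

lemma config_free_empty: "P \<noteq> {} \<Longrightarrow> config_free P {}"
  by (auto simp: config_free_def contains_config_def)

lemma contains_config_scaleR:
  assumes "contains_config S P" and c: "c \<ge> 1"
  shows "contains_config ((\<lambda>p. c *\<^sub>R p) ` S) P"
proof -
  obtain f g
    where fq: "\<forall>x\<in>fst ` P. \<forall>y\<in>fst ` P. x > y \<longrightarrow> (f x - f y) / (x - y) \<ge> 1"
      and gq: "\<forall>x\<in>snd ` P. \<forall>y\<in>snd ` P. x > y \<longrightarrow> (g x - g y) / (x - y) \<ge> 1"
      and S: "\<forall>(x, y)\<in>P. (f x, g y) \<in> S"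
    using assms(1) unfolding contains_config_def by (elim exE conjE) (rule that)
  have quot: "(c * a - c * b) / d \<ge> 1" if "(a - b) / d \<ge> 1" for a b d :: real
    using mult_mono[OF c that] c by (simp add: right_diff_distrib)
  have mem: "(c * f x, c * g y) \<in> (\<lambda>p. c *\<^sub>R p) ` S" if "(x, y) \<in> P" for x y
    using S that by (intro image_eqI[of _ _ "(f x, g y)"]) auto
  show ?thesis
    unfolding contains_config_def
  proof (rule exI[of _ "\<lambda>x. c * f x"], rule exI[of _ "\<lambda>y. c * g y"], intro conjI ballI impI)
    \<comment> \<open>A first coordinate belongs to some point of \<open>P\<close>; the scaled maps
      send that point into the scaled set, and projecting gives the range condition.\<close>
    show "(\<lambda>x. c * f x) \<in> fst ` P \<rightarrow> fst ` (\<lambda>p. c *\<^sub>R p) ` S"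
    proof
      fix x
      assume "x \<in> fst ` P"
      then obtain y where "(x, y) \<in> P"
        by auto
      from imageI[OF mem[OF this], of fst]
      show "c * f x \<in> fst ` (\<lambda>p. c *\<^sub>R p) ` S"
        by simp
    qed
    show "(\<lambda>y. c * g y) \<in> snd ` P \<rightarrow> snd ` (\<lambda>p. c *\<^sub>R p) ` S"
    proof
      fix y
      assume "y \<in> snd ` P"
      then obtain x where "(x, y) \<in> P"
        by auto
      from imageI[OF mem[OF this], of snd]
      show "c * g y \<in> snd ` (\<lambda>p. c *\<^sub>R p) ` S"
        by simp
    qed
    show "(c * f x - c * f y) / (x - y) \<ge> 1" if "x \<in> fst ` P" "y \<in> fst ` P" "x > y" for x y
      by (intro quot bspec[OF bspec[OF fq], THEN mp] that)
    show "(c * g x - c * g y) / (x - y) \<ge> 1" if "x \<in> snd ` P" "y \<in> snd ` P" "x > y" for x y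
      by (intro quot bspec[OF bspec[OF gq], THEN mp] that)
    show "case p of (x, y) \<Rightarrow> (c * f x, c * g y) \<in> (\<lambda>p. c *\<^sub>R p) ` S" if "p \<in> P" for p
      using mem that by (cases p) simp
  qed
qed

text \<open>A containment of \<open>P\<close> in the shrunken set, magnified by
  \<open>inverse c\<close>, would be a containment in \<open>S\<close> itself.\<close>

lemma config_free_scaleR:
  assumes "config_free P S" "0 < c" "c \<le> 1"
  shows "config_free P ((\<lambda>p. c *\<^sub>R p) ` S)"
proof -
  have "(\<lambda>p. inverse c *\<^sub>R p) ` (\<lambda>p. c *\<^sub>R p) ` S = S"
    using assms(2) by (simp add: image_image)
  then show ?thesis
    using assms contains_config_scaleR[of "(\<lambda>p. c *\<^sub>R p) ` S" P "inverse c"]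
    by (auto simp: config_free_def one_le_inverse)
qed

lemma opx_bdd_above:
  "bdd_above {measure lebesgue S | S. open S \<and> config_free P S \<and> S \<subseteq> {0..n} \<times> {0..n}}"
proof (rule bdd_aboveI, clarify)
  fix S :: "(real \<times> real) set"
  assume "open S" "S \<subseteq> {0..n} \<times> {0..n}"
  \<comment> \<open>As a closed box the square has finite measure, so monotonicity of the measure
    applies.\<close>
  moreover have "{0..n} \<times> {0..n} = cbox (0, 0) (n, n)"
    by (simp add: cbox_Pair_eq)
  ultimately show "measure lebesgue S \<le> measure lebesgue ({0..n} \<times> {0..n})"
    by (intro measure_mono_fmeasurable) auto
qed

lemma opx_upper:
  "open S \<Longrightarrow> config_free P S \<Longrightarrow> S \<subseteq> {0..n} \<times> {0..n} \<Longrightarrow> measure lebesgue S \<le> opx n P"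
  unfolding opx_def by (rule cSup_upper[OF _ opx_bdd_above]) blast

lemma opx_least:
  assumes "P \<noteq> {}"
    and "\<And>S. open S \<Longrightarrow> config_free P S \<Longrightarrow> S \<subseteq> {0..n} \<times> {0..n} \<Longrightarrow> measure lebesgue S \<le> b"
  shows "opx n P \<le> b"
  unfolding opx_def
proof (rule cSup_least)
  show "{measure lebesgue S | S. open S \<and> config_free P S \<and> S \<subseteq> {0..n} \<times> {0..n}} \<noteq> {}"
    using config_free_empty[OF assms(1)] by blast
qed (use assms(2) in blast)

lemma opx_mono:
  assumes "P \<noteq> {}" "m \<le> n"
  shows "opx m P \<le> opx n P"
proof (rule opx_least[OF assms(1)])
  fix S :: "(real \<times> real) set"
  assume S: "open S" "config_free P S" "S \<subseteq> {0..m} \<times> {0..m}"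
  have "S \<subseteq> {0..n} \<times> {0..n}"
    using assms(2) by (intro subset_trans[OF S(3)]) auto
  with S show "measure lebesgue S \<le> opx n P"
    by (intro opx_upper)
qed

text \<open>Scaling by \<open>c\<close> turns each admissible set for side \<open>n\<close> into one
  for side \<open>c * n\<close> and multiplies its area by the square of \<open>c\<close>.\<close>

lemma opx_scale:
  assumes "P \<noteq> {}" "0 < c" "c \<le> 1"
  shows "c\<^sup>2 * opx n P \<le> opx (c * n) P"
proof -
  \<comment> \<open>Dividing by the square of \<open>c\<close> leaves a bound on each single area
    that does not depend on the set, as \<open>opx_least\<close> requires.\<close>
  have "opx n P \<le> opx (c * n) P / c\<^sup>2"
  proof (rule opx_least[OF assms(1)])
    fix S :: "(real \<times> real) set"
    assume S: "open S" "config_free P S" "S \<subseteq> {0..n} \<times> {0..n}"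
    have "measure lebesgue ((\<lambda>p. c *\<^sub>R p) ` S) \<le> opx (c * n) P"
    proof (rule opx_upper)
      show "open ((\<lambda>p. c *\<^sub>R p) ` S)"
        using S(1) assms(2) by (simp add: open_scaling)
      show "config_free P ((\<lambda>p. c *\<^sub>R p) ` S)"
        using S(2) assms by (intro config_free_scaleR)
      show "(\<lambda>p. c *\<^sub>R p) ` S \<subseteq> {0..c * n} \<times> {0..c * n}"
        using S(3) assms(2) by (auto dest!: subsetD intro!: mult_left_mono)
    qed
    moreover have "measure lebesgue ((\<lambda>p. c *\<^sub>R p) ` S) = c\<^sup>2 * measure lebesgue S"
      using measure_lebesgue_affine[of c 0 S] assms(2) by (simp add: power2_eq_square)
    ultimately show "measure lebesgue S \<le> opx (c * n) P / c\<^sup>2"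
      using assms(2) by (simp add: field_simps)
  qed
  then show ?thesis
    using assms(2) by (simp add: field_simps)
qed

theorem proposition2p7:
  fixes P :: "(real \<times> real) set"
  shows "continuous_on {0<..} (\<lambda>n. opx n P)"
proof (cases "P = {}")
  case True
  \<comment> \<open>No set is free of the empty configuration, so the supremum is over the empty
    family for every \<open>n\<close> and \<open>opx\<close> is constant.\<close>
  then show ?thesis
    by (simp add: opx_def config_free_def contains_config_empty)
next
  case False
  show ?thesis
    unfolding continuous_on_eq_continuous_at[OF open_greaterThan] isCont_def
  proof
    fix a :: real
    assume "a \<in> {0<..}"
    then have a: "a > 0"
      by simp
    \<comment> \<open>Using \<open>min\<close> and \<open>max\<close> gives one pair of bounds on
      both sides of \<open>a\<close>, so no one-sided limits arise.\<close>
    have bounds: "min 1 ((x / a)\<^sup>2) * opx a P \<le> opx x P \<and> opx x P \<le> max 1 ((x / a)\<^sup>2) * opx a P"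
      if x: "x > 0" for x
    proof (cases "x \<le> a")
      case True
      have "(x / a)\<^sup>2 * opx a P \<le> opx x P"
        using opx_scale[OF False, of "x / a" a] a x True by simp
      moreover have "(x / a)\<^sup>2 \<le> 1"
        using a x True by (simp add: power_le_one)
      ultimately show ?thesis
        using opx_mono[OF False True] by simp
    next
      case gt: False
      \<comment> \<open>Now \<open>x\<close> is the larger side, so scaling by \<open>a / x\<close>
        shrinks side \<open>x\<close> to side \<open>a\<close>.\<close>
      have "(a / x)\<^sup>2 * opx x P \<le> opx a P"
        using opx_scale[OF False, of "a / x" x] a x gt by simp
      then have "opx x P \<le> (x / a)\<^sup>2 * opx a P"
        using a x by (simp add: power_divide field_simps)
      moreover have "(x / a)\<^sup>2 \<ge> 1"
        using a x gt by (simp add: one_le_power)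
      ultimately show ?thesis
        using opx_mono[OF False, of a x] gt by simp
    qed
    have ev: "\<forall>\<^sub>F x in at a. x > 0"
      using a by (intro order_tendstoD(1)[OF tendsto_ident_at])
    \<comment> \<open>Both outer factors are continuous and equal 1 at \<open>a\<close>, so both
      bounds tend to \<open>opx a P\<close>.\<close>
    have "((\<lambda>x. min 1 ((x / a)\<^sup>2) * opx a P) \<longlongrightarrow> min 1 ((a / a)\<^sup>2) * opx a P) (at a)"
      using a by (intro tendsto_intros) auto
    then have lower: "((\<lambda>x. min 1 ((x / a)\<^sup>2) * opx a P) \<longlongrightarrow> opx a P) (at a)"
      using a by simp
    have "((\<lambda>x. max 1 ((x / a)\<^sup>2) * opx a P) \<longlongrightarrow> max 1 ((a / a)\<^sup>2) * opx a P) (at a)"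
      using a by (intro tendsto_intros) auto
    then have upper: "((\<lambda>x. max 1 ((x / a)\<^sup>2) * opx a P) \<longlongrightarrow> opx a P) (at a)"
      using a by simp
    show "((\<lambda>n. opx n P) \<longlongrightarrow> opx a P) (at a)"
      by (rule tendsto_sandwich[OF eventually_mono[OF ev] eventually_mono[OF ev] lower upper])
        (use bounds in blast)+
  qed
qed

end
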